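(* Let $m,n$ be positive integers. If $n\ge 2$, then $$f_m(n,2)=mn+m.$$ If $k\in\{3,4\}$ and $n\ge k-1$, then $$mn+(m+1)(k-1)-1\le f_m(n,k)\le mn+m\binom{k}{2}.$$
   Context: For positive integers $m,n$ let $mB^n=\{0,1,\ldots,m\}^n\subseteq\mathbb{R}^n$. A family of affine hyperplanes in $\mathbb{R}^n$ is a finite multiset, so repetitions are allowed and counted. A point is covered $j$ times by the family if exactly $j$ members of the multiset contain it. For a positive integer $k$, $f_m(n,k)$ denotes the minimum size of a family of affine hyperplanes in $\mathbb{R}^n$ such that every point of $mB^n\setminus\{\mathbf 0\}$ is covered at least $k$ times and the origin $\mathbf 0$ is covered by no member of the family. *)

theory Defs
  imports Complex_Main "HOL-Library.Multiset"
begin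

text \<open>Points of R^n are functions nat => real, only coordinates i < n matter.
An affine hyperplane in R^n is given by a pair (a, b) with a restricted to
{0..<n} nonzero; it is the set of x with sum_{i<n} a i * x i = b.\<close>

type_synonym hplane = "(nat \<Rightarrow> real) \<times> real"

definition is_hyperplane :: "nat \<Rightarrow> hplane \<Rightarrow> bool" where
  "is_hyperplane n h \<longleftrightarrow> (\<exists>i<n. fst h i \<noteq> 0)"

definition on_hp :: "nat \<Rightarrow> hplane \<Rightarrow> (nat \<Rightarrow> real) \<Rightarrow> bool" where
  "on_hp n h x \<longleftrightarrow> (\<Sum>i<n. fst h i * x i) = snd h"

definition grid :: "nat \<Rightarrow> nat \<Rightarrow> (nat \<Rightarrow> real) set" where
  "grid m n = {x. (\<forall>i<n. x i \<in> real ` {0..m}) \<and> (\<forall>i\<ge>n. x i = 0)}"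

definition cov :: "nat \<Rightarrow> hplane multiset \<Rightarrow> (nat \<Rightarrow> real) \<Rightarrow> nat" where
  "cov n H x = size (filter_mset (\<lambda>h. on_hp n h x) H)"

definition admissible :: "nat \<Rightarrow> nat \<Rightarrow> nat \<Rightarrow> hplane multiset \<Rightarrow> bool" where
  "admissible m n k H \<longleftrightarrow>
     (\<forall>h\<in>#H. is_hyperplane n h) \<and>
     (\<forall>x\<in>grid m n - {(\<lambda>_. 0)}. cov n H x \<ge> k) \<and>
     cov n H (\<lambda>_. 0) = 0"

definition f :: "nat \<Rightarrow> nat \<Rightarrow> nat \<Rightarrow> nat" where
  "f m n k = (LEAST s. \<exists>H. admissible m n k H \<and> size H = s)"

end

theory Submission
  imports Defs "HOL-Library.FuncSet"
begin

text \<open>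
  Let P be the product of the affine forms of an admissible family: it vanishes to order k at every
  nonzero grid point and not at the origin. In one variable, let \<open>A(d, e)\<close> be the divided difference
  with node 0 of multiplicity d + 1 and nodes 1, ..., m of multiplicity e; it annihilates
  polynomials of degree less than d + em. A tensor product of such functionals with
  \<open>\<Sum>(e\<^sub>i - 1) < k\<close> annihilates P if deg P is less than \<open>\<Sum>(d\<^sub>i + e\<^sub>i m)\<close>, and only derivatives of P at
  the origin contribute to its value. This is a linear relation between those derivatives; its
  coefficients are those of powers of \<open>\<Prod>\<^sub>j 1 / (1 - x / j)\<close>. Combining one relation for k = 2, two
  for k = 3 and four for k = 4, all derivatives of positive order cancel and a positive multiple
  of P(0) is left, a contradiction.

  For the upper bound take the planes \<open>x\<^sub>i = j\<close> and, for w < k - 1 and 1 \<open>\<le>\<close> t \<open>\<le>\<close> m,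
  k - 1 - w copies of the plane where the coordinate sum is wm + t: a point with c nonzero
  coordinates lies on c planes of the first kind, and its coordinate sum is at most cm.
\<close>

section \<open>One-variable functionals supported at nodes, and their division by
  \<open>1 - x / v\<close>\<close>

text \<open>A linear functional on polynomials is represented by its values on the monomials; this is
  the functional \<open>p \<mapsto> p\<^sup>(\<^sup>s\<^sup>)(v) / s!\<close> evaluated at \<open>x\<^sup>i\<close>.\<close>

definition taylor :: "real \<Rightarrow> nat \<Rightarrow> nat \<Rightarrow> real" where
  "taylor v s i = real (i choose s) * v ^ (i - s)"

lemma taylor_Suc_0: "taylor v 0 (Suc i) = v * taylor v 0 i"
  by (simp add: taylor_def)

lemma taylor_Suc_Suc: "taylor v (Suc s) (Suc i) = v * taylor v (Suc s) i + taylor v s i"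
proof (cases "s < i")
  case True
  then have "v ^ (i - s) = v * v ^ (i - Suc s)"
    by (metis Suc_diff_Suc power_Suc)
  then show ?thesis
    by (simp add: taylor_def algebra_simps)
next
  case False
  then show ?thesis
    by (simp add: taylor_def binomial_eq_0)
qed

text \<open>Leibniz rule for \<open>x * p\<close> at \<open>v\<close>; order 0 has no lower
  term.\<close>

lemma taylor_Suc:
  "taylor v s (Suc i) = v * taylor v s i + (if s = 0 then 0 else taylor v (s - 1) i)"
  by (cases s) (simp_all add: taylor_Suc_0 taylor_Suc_Suc)

lemma taylor_at_0: "taylor 0 s i = (if i = s then 1 else 0)"
  by (auto simp: taylor_def binomial_eq_0 power_0_left)

text \<open>A functional a multiplied by \<open>1 - x / v\<close> is \<open>\<lambda>i. a i - a (Suc i) / v\<close>. Functionals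
  supported at given nodes can be divided by \<open>1 - x / v\<close>; at the node v itself this raises the order
  by one and leaves the value coefficient free.\<close>

lemma jet_divide_other_node:
  fixes v w :: real
  assumes "v \<noteq> 0" "w \<noteq> v"
  shows "\<exists>c'. \<forall>i. (\<Sum>s<E. c' s * taylor w s i) - (\<Sum>s<E. c' s * taylor w s (Suc i)) / v
              = (\<Sum>s<E. c s * taylor w s i)"
proof (induction E arbitrary: c)
  case 0
  show ?case by simp
next
  case (Suc E)
  \<comment> \<open>On jets at \<open>w\<close>, multiplication by \<open>1 - x / v\<close> is
    triangular with diagonal \<open>1 - w / v\<close>, nonzero as \<open>w \<noteq> v\<close>, so
    one solves from the top order down. The term of order \<open>E\<close> leaves
    \<open>- b / v\<close> at order \<open>E - 1\<close>, which \<open>d\<close>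
    compensates.\<close>
  define b where "b = c E / (1 - w / v)"
  have b: "b * (1 - w / v) = c E"
    using assms by (simp add: b_def field_simps)
  define d where "d = (\<lambda>s. if Suc s = E then c s + b / v else c s)"
  obtain c' where c': "\<And>i. (\<Sum>s<E. c' s * taylor w s i) - (\<Sum>s<E. c' s * taylor w s (Suc i)) / v
      = (\<Sum>s<E. d s * taylor w s i)"
    using Suc.IH[of d] by blast
  have d: "(\<Sum>s<E. d s * taylor w s i)
      = (\<Sum>s<E. c s * taylor w s i) + (if E = 0 then 0 else b / v * taylor w (E - 1) i)" for i
    by (cases E) (simp_all add: d_def algebra_simps)
  define c2 where "c2 = c'(E := b)"
  have c2: "(\<Sum>s<Suc E. c2 s * taylor w s i) = (\<Sum>s<E. c' s * taylor w s i) + b * taylor w E i" for i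
    by (simp add: c2_def)
  have "(\<Sum>s<Suc E. c2 s * taylor w s i) - (\<Sum>s<Suc E. c2 s * taylor w s (Suc i)) / v
      = (\<Sum>s<Suc E. c s * taylor w s i)" for i
  proof -
    have "(\<Sum>s<Suc E. c2 s * taylor w s i) - (\<Sum>s<Suc E. c2 s * taylor w s (Suc i)) / v
        = (\<Sum>s<E. d s * taylor w s i) + b * taylor w E i - b * taylor w E (Suc i) / v"
      unfolding c2 c'[symmetric] by (simp add: add_divide_distrib)
    also have "\<dots> = (\<Sum>s<E. c s * taylor w s i) + b * (1 - w / v) * taylor w E i"
      unfolding d taylor_Suc[of w E] by (simp add: algebra_simps add_divide_distrib)
    finally show ?thesis by (simp add: b)
  qed
  then show ?case by blast
qed

lemma jet_divide_same_node:
  fixes v z :: real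
  assumes "v \<noteq> 0"
  shows "\<exists>c'. c' 0 = z \<and>
    (\<forall>i. (\<Sum>s<Suc E. c' s * taylor v s i) - (\<Sum>s<Suc E. c' s * taylor v s (Suc i)) / v
       = (\<Sum>s<E. c s * taylor v s i))"
proof (intro exI conjI allI)
  \<comment> \<open>At its own zero \<open>v\<close> the factor lowers each order by one, scaling by
    \<open>- 1 / v\<close>, and kills order 0, whose coefficient \<open>z\<close> is therefore
    free.\<close>
  let ?c = "\<lambda>s. case s of 0 \<Rightarrow> z | Suc t \<Rightarrow> - v * c t"
  show "?c 0 = z" by simp
  fix i
  have "?c s * taylor v s i - ?c s * taylor v s (Suc i) / v
      = (case s of 0 \<Rightarrow> 0 | Suc t \<Rightarrow> c t * taylor v t i)" for s
    using assms by (cases s) (simp_all add: taylor_Suc field_simps)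
  then show "(\<Sum>s<Suc E. ?c s * taylor v s i) - (\<Sum>s<Suc E. ?c s * taylor v s (Suc i)) / v
       = (\<Sum>s<E. c s * taylor v s i)"
    by (simp only: sum_divide_distrib sum_subtractf[symmetric])
      (simp add: sum.lessThan_Suc_shift del: sum.lessThan_Suc)
qed

text \<open>Node 0 is left out: its coefficients will be explicit, while those at 1, ..., m only
  have to exist.\<close>

definition jet_sum :: "nat \<Rightarrow> (nat \<Rightarrow> nat) \<Rightarrow> (nat \<Rightarrow> nat \<Rightarrow> real) \<Rightarrow> nat \<Rightarrow> real" where
  "jet_sum m E c i = (\<Sum>w=1..m. \<Sum>s<E w. c w s * taylor (real w) s i)"

lemma jet_sum_divide:
  assumes v: "v \<in> {1..m}"
  shows "\<exists>c'. jet_sum m (E(v := Suc (E v))) c' 0 = z \<and>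
    (\<forall>i. jet_sum m (E(v := Suc (E v))) c' i - jet_sum m (E(v := Suc (E v))) c' (Suc i) / real v
       = jet_sum m E c i)"
proof -
  have "\<exists>c'. \<forall>i. w \<noteq> v \<longrightarrow> (\<Sum>s<E w. c' s * taylor (real w) s i)
      - (\<Sum>s<E w. c' s * taylor (real w) s (Suc i)) / real v
      = (\<Sum>s<E w. c w s * taylor (real w) s i)" for w
  proof (cases "w = v")
    case False
    then show ?thesis
      using jet_divide_other_node[of "real v" "real w" "E w" "c w"] v by simp
  qed simp
  then have "\<forall>w. \<exists>c'. \<forall>i. w \<noteq> v \<longrightarrow> (\<Sum>s<E w. c' s * taylor (real w) s i)
      - (\<Sum>s<E w. c' s * taylor (real w) s (Suc i)) / real v
      = (\<Sum>s<E w. c w s * taylor (real w) s i)" ..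
  from choice[OF this] obtain b where b: "\<And>w i. w \<noteq> v \<Longrightarrow> (\<Sum>s<E w. b w s * taylor (real w) s i)
      - (\<Sum>s<E w. b w s * taylor (real w) s (Suc i)) / real v
      = (\<Sum>s<E w. c w s * taylor (real w) s i)"
    by blast
  define rest where "rest = (\<lambda>i. \<Sum>w\<in>{1..m} - {v}. \<Sum>s<E w. b w s * taylor (real w) s i)"
  \<comment> \<open>Only order 0 counts on the constant monomial, so this \<open>bv 0\<close> makes
    the total there equal to \<open>z\<close>.\<close>
  obtain bv where bv: "bv 0 = z - rest 0"
    "\<And>i. (\<Sum>s<Suc (E v). bv s * taylor v s i) - (\<Sum>s<Suc (E v). bv s * taylor v s (Suc i)) / real v
       = (\<Sum>s<E v. c v s * taylor v s i)"
    using jet_divide_same_node[of "real v" "z - rest 0" "E v" "c v"] v by auto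
  define c' where "c' = b(v := bv)"
  have js: "jet_sum m (E(v := Suc (E v))) c' i = (\<Sum>s<Suc (E v). bv s * taylor v s i) + rest i" for i
  proof -
    have "jet_sum m (E(v := Suc (E v))) c' i = (\<Sum>s<Suc (E v). bv s * taylor v s i)
      + (\<Sum>w\<in>{1..m} - {v}. \<Sum>s<(E(v := Suc (E v))) w. c' w s * taylor (real w) s i)"
      unfolding jet_sum_def using v by (subst sum.remove[of _ v]) (simp_all add: c'_def)
    also have "(\<Sum>w\<in>{1..m} - {v}. \<Sum>s<(E(v := Suc (E v))) w. c' w s * taylor (real w) s i) = rest i"
      unfolding rest_def by (intro sum.cong) (auto simp: c'_def)
    finally show ?thesis .
  qed
  have "(\<Sum>s<Suc (E v). bv s * taylor v s 0) = bv 0"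
    by (simp add: sum.lessThan_Suc_shift taylor_def del: sum.lessThan_Suc)
  then have "jet_sum m (E(v := Suc (E v))) c' 0 = z"
    unfolding js using bv(1) by simp
  moreover have "jet_sum m (E(v := Suc (E v))) c' i
      - jet_sum m (E(v := Suc (E v))) c' (Suc i) / real v = jet_sum m E c i" for i
  proof -
    have "rest i - rest (Suc i) / real v
        = (\<Sum>w\<in>{1..m} - {v}. \<Sum>s<E w. c w s * taylor (real w) s i)"
      unfolding rest_def sum_divide_distrib[of _ "{1..m} - {v}"] sum_subtractf[symmetric]
      by (intro sum.cong) (auto simp: b)
    moreover have "jet_sum m E c i = (\<Sum>s<E v. c v s * taylor v s i)
        + (\<Sum>w\<in>{1..m} - {v}. \<Sum>s<E w. c w s * taylor (real w) s i)"
      unfolding jet_sum_def using v by (subst sum.remove[of _ v]) simp_all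
    ultimately show ?thesis
      unfolding js using bv(2)[of i] by (simp add: add_divide_distrib)
  qed
  ultimately show ?thesis by blast
qed

section \<open>Annihilating functionals and their coefficients at the origin\<close>

text \<open>The coefficients of the power series \<open>\<Prod>\<^sub>w 1 / (1 - x / w)\<close>.\<close>

fun chom :: "nat list \<Rightarrow> nat \<Rightarrow> real" where
  "chom [] r = (if r = 0 then 1 else 0)"
| "chom (w # ws) 0 = chom ws 0"
| "chom (w # ws) (Suc r) = chom ws (Suc r) + chom (w # ws) r / real w"

lemma chom_0: "chom ws 0 = 1"
  by (induction ws) auto

lemma chom_1: "chom ws 1 = (\<Sum>w\<leftarrow>ws. 1 / real w)"
  by (induction ws) (auto simp: chom_0)

text \<open>\<open>chom ws r\<close> is the complete homogeneous symmetric polynomial of degree r in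
  the reciprocals; this is the identity h_2 = (p_1^2 + p_2) / 2 with power sums.\<close>

lemma chom_2: "chom ws 2 = ((\<Sum>w\<leftarrow>ws. 1 / real w)\<^sup>2 + (\<Sum>w\<leftarrow>ws. (1 / real w)\<^sup>2)) / 2"
proof (induction ws)
  case Nil
  show ?case by simp
next
  case (Cons w ws)
  have "chom (w # ws) 2 = chom ws 2 + chom (w # ws) 1 / real w"
    by (simp add: numeral_2_eq_2)
  then show ?case
    unfolding Cons.IH chom_1 by (simp add: power2_eq_square add_divide_distrib algebra_simps)
qed

text \<open>Start from \<open>p \<mapsto> p\<^sup>(\<^sup>d\<^sup>)(0) / d!\<close> and divide successively by \<open>1 - x / w\<close>, each time using the
  free coefficient at w to make the functional vanish on constants.\<close>

lemma annihilating_jet_sum: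
  assumes "set ws \<subseteq> {1..m}"
  shows "\<exists>c. \<forall>i < d + length ws.
    (if i \<le> d then chom ws (d - i) else 0) + jet_sum m (count_list ws) c i = 0"
  using assms
proof (induction ws)
  case Nil
  show ?case by (auto simp: jet_sum_def)
next
  case (Cons v ws)
  define A where "A = (\<lambda>c i. (if i \<le> d then chom ws (d - i) else 0) + jet_sum m (count_list ws) c i)"
  obtain c where c: "\<And>i. i < d + length ws \<Longrightarrow> A c i = 0"
    using Cons unfolding A_def by auto
  have E: "count_list (v # ws) = (count_list ws)(v := Suc (count_list ws v))"
    by (auto simp: fun_eq_iff)
  obtain c' where c': "jet_sum m (count_list (v # ws)) c' 0 = - chom (v # ws) d"
    "\<And>i. jet_sum m (count_list (v # ws)) c' i - jet_sum m (count_list (v # ws)) c' (Suc i) / real v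
       = jet_sum m (count_list ws) c i"
    using jet_sum_divide[of v m "count_list ws" "- chom (v # ws) d" c] Cons.prems
    unfolding E by auto
  define B where "B = (\<lambda>i. (if i \<le> d then chom (v # ws) (d - i) else 0)
    + jet_sum m (count_list (v # ws)) c' i)"
  have v: "real v > 0" using Cons.prems by auto
  \<comment> \<open>At node 0, dividing by \<open>1 - x / v\<close> multiplies by the geometric
    series in \<open>x / v\<close>, which is the recursion of \<open>chom\<close>.\<close>
  have loc: "(if i \<le> d then chom (v # ws) (d - i) else 0)
      - (if Suc i \<le> d then chom (v # ws) (d - Suc i) else 0) / real v
      = (if i \<le> d then chom ws (d - i) else 0)" for i
  proof (cases "Suc i \<le> d")
    case True
    then obtain r where "d - i = Suc r" "d - Suc i = r"
      by (metis Suc_diff_Suc Suc_le_eq)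
    with True show ?thesis by simp
  qed auto
  have step: "B i - B (Suc i) / real v = A c i" for i
    unfolding B_def A_def using loc[of i] c'(2)[of i] by (simp add: add_divide_distrib)
  \<comment> \<open>\<open>B 0 = 0\<close> by the choice of the free coefficient;
    \<open>step\<close> then carries the zeros one degree further than those of
    \<open>A c\<close>.\<close>
  have "B i = 0" if "i < Suc (d + length ws)" for i
    using that
  proof (induction i)
    case 0
    show ?case by (simp add: B_def c'(1))
  next
    case (Suc i)
    with step[of i] c[of i] v show ?case by simp
  qed
  then show ?case
    unfolding B_def by (intro exI[of _ c']) (simp del: count_list.simps)
qed

definition hcoeff :: "nat \<Rightarrow> nat \<Rightarrow> nat \<Rightarrow> real" where
  "hcoeff m e = chom (concat (replicate e [1..<Suc m]))"

text \<open>Pairs of a node and an order of derivative.\<close>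

definition nodes :: "nat \<Rightarrow> nat \<Rightarrow> nat \<Rightarrow> (nat \<times> nat) set" where
  "nodes m d e = {0} \<times> {..d} \<union> {1..m} \<times> {..<e}"

lemma hcoeff_0: "hcoeff m e 0 = 1"
  by (simp add: hcoeff_def chom_0)

lemma sum_list_concat_replicate:
  "(\<Sum>x\<leftarrow>concat (replicate e xs). g x) = real e * (\<Sum>x\<leftarrow>xs. g x)"
  by (induction e) (simp_all add: algebra_simps)

lemma sum_list_upt_Suc: "(\<Sum>j\<leftarrow>[1..<Suc m]. (g j :: real)) = (\<Sum>j=1..m. g j)"
  by (simp add: interv_sum_list_conv_sum_set_nat atLeastLessThanSuc_atLeastAtMost del: upt_Suc)

lemma hcoeff_1: "hcoeff m e 1 = real e * (\<Sum>j=1..m. 1 / real j)"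
  by (simp only: hcoeff_def chom_1 sum_list_concat_replicate sum_list_upt_Suc)

lemma hcoeff_2: "hcoeff m e 2
    = ((real e * (\<Sum>j=1..m. 1 / real j))\<^sup>2 + real e * (\<Sum>j=1..m. (1 / real j)\<^sup>2)) / 2"
  by (simp only: hcoeff_def chom_2 sum_list_concat_replicate sum_list_upt_Suc)

text \<open>The functional \<open>A(d, e)\<close>, scaled to have coefficient 1 at the top
  derivative \<open>(0, d)\<close>.\<close>

lemma annihilating_functional:
  "\<exists>\<kappa>. (\<forall>s\<le>d. \<kappa> (0, s) = hcoeff m e (d - s)) \<and>
     (\<forall>i < d + e * m. (\<Sum>p\<in>nodes m d e. \<kappa> p * taylor (real (fst p)) (snd p) i) = 0)"
proof -
  define ws where "ws = concat (replicate e [1..<Suc m])"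
  have len: "length ws = e * m"
    unfolding ws_def by (induction e) (auto simp del: upt_Suc)
  have cnt: "count_list ws w = e" if "w \<in> {1..m}" for w
  proof -
    have "count_list [1..<Suc m] w = (if w \<in> {1..m} then 1 else 0)"
      by (induction m) auto
    with that show ?thesis unfolding ws_def by (induction e) (auto simp del: upt_Suc)
  qed
  have "set ws \<subseteq> {1..m}"
    by (auto simp: ws_def simp del: upt_Suc split: if_splits)
  then obtain c where c: "\<And>i. i < d + e * m \<Longrightarrow>
      (if i \<le> d then chom ws (d - i) else 0) + jet_sum m (count_list ws) c i = 0"
    using annihilating_jet_sum[of ws m d] unfolding len by blast
  define \<kappa> where "\<kappa> = (\<lambda>p. if fst p = 0 then chom ws (d - snd p) else c (fst p) (snd p))"
  have "(\<Sum>p\<in>nodes m d e. \<kappa> p * taylor (real (fst p)) (snd p) i)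
      = (if i \<le> d then chom ws (d - i) else 0) + jet_sum m (count_list ws) c i" for i
  proof -
    have "(\<Sum>p\<in>nodes m d e. \<kappa> p * taylor (real (fst p)) (snd p) i)
      = (\<Sum>p\<in>{0} \<times> {..d}. \<kappa> p * taylor (real (fst p)) (snd p) i)
      + (\<Sum>p\<in>{1..m} \<times> {..<e}. \<kappa> p * taylor (real (fst p)) (snd p) i)"
      unfolding nodes_def by (rule sum.union_disjoint) auto
    also have "(\<Sum>p\<in>{0} \<times> {..d}. \<kappa> p * taylor (real (fst p)) (snd p) i)
        = (\<Sum>s\<le>d. \<kappa> (0, s) * taylor 0 s i)"
      by (subst sum.cartesian_product') simp
    also have "\<dots> = (if i \<le> d then chom ws (d - i) else 0)"
      by (simp add: taylor_at_0 \<kappa>_def if_distrib cong: if_cong)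
    also have "(\<Sum>p\<in>{1..m} \<times> {..<e}. \<kappa> p * taylor (real (fst p)) (snd p) i)
        = jet_sum m (count_list ws) c i"
      unfolding jet_sum_def by (subst sum.cartesian_product') (auto intro!: sum.cong simp: \<kappa>_def cnt)
    finally show ?thesis .
  qed
  then show ?thesis
    using c by (intro exI[of _ \<kappa>]) (auto simp: \<kappa>_def hcoeff_def ws_def simp del: upt_Suc)
qed

section \<open>Functionals in n variables and products of affine forms\<close>

text \<open>A functional on polynomials in n variables is given by its values on the monomials, indexed
  by their exponents. It is acted on by the affine form of h through the transpose of
  multiplication, so that \<open>eval_prod\<close> is the value of the functional at the product of the forms.\<close>

definition apply_form ::
  "nat \<Rightarrow> hplane \<Rightarrow> ((nat \<Rightarrow> nat) \<Rightarrow> real) \<Rightarrow> (nat \<Rightarrow> nat) \<Rightarrow> real" where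
  "apply_form n h \<phi> \<beta> = (\<Sum>i<n. fst h i * \<phi> (\<beta>(i := Suc (\<beta> i)))) - snd h * \<phi> \<beta>"

fun eval_prod :: "nat \<Rightarrow> hplane list \<Rightarrow> ((nat \<Rightarrow> nat) \<Rightarrow> real) \<Rightarrow> real" where
  "eval_prod n [] \<phi> = \<phi> (\<lambda>_. 0)"
| "eval_prod n (h # hs) \<phi> = eval_prod n hs (apply_form n h \<phi>)"

text \<open>One distinguished term plus a finite sum is the shape of the Leibniz expansion in
  \<open>apply_form_jet\<close>.\<close>

lemma apply_form_linear:
  "apply_form n h (\<lambda>\<alpha>. a * \<phi> \<alpha> + (\<Sum>j\<in>S. c j * \<psi> j \<alpha>))
    = (\<lambda>\<alpha>. a * apply_form n h \<phi> \<alpha> + (\<Sum>j\<in>S. c j * apply_form n h (\<psi> j) \<alpha>))"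
proof
  fix \<beta>
  have "(\<Sum>i<n. fst h i * (\<Sum>j\<in>S. c j * \<psi> j (\<beta>(i := Suc (\<beta> i)))))
      = (\<Sum>j\<in>S. c j * (\<Sum>i<n. fst h i * \<psi> j (\<beta>(i := Suc (\<beta> i)))))"
    by (simp add: sum_distrib_left sum.swap[of _ S] mult.left_commute)
  then show "apply_form n h (\<lambda>\<alpha>. a * \<phi> \<alpha> + (\<Sum>j\<in>S. c j * \<psi> j \<alpha>)) \<beta>
    = a * apply_form n h \<phi> \<beta> + (\<Sum>j\<in>S. c j * apply_form n h (\<psi> j) \<beta>)"
    by (simp add: apply_form_def algebra_simps sum.distrib sum_subtractf sum_distrib_left)
qed

lemma eval_prod_linear:
  "eval_prod n hs (\<lambda>\<alpha>. a * \<phi> \<alpha> + (\<Sum>j\<in>S. c j * \<psi> j \<alpha>))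
    = a * eval_prod n hs \<phi> + (\<Sum>j\<in>S. c j * eval_prod n hs (\<psi> j))"
proof (induction hs arbitrary: \<phi> \<psi>)
  case Nil
  show ?case by simp
next
  case (Cons h hs)
  show ?case by (simp only: eval_prod.simps apply_form_linear Cons.IH)
qed

lemma eval_prod_sum:
  "eval_prod n hs (\<lambda>\<alpha>. \<Sum>j\<in>S. c j * \<psi> j \<alpha>) = (\<Sum>j\<in>S. c j * eval_prod n hs (\<psi> j))"
  using eval_prod_linear[where a = 0] by simp

text \<open>Each form raises the degree of a monomial by at most one, so transposing it lowers the
  degree bound by at most one.\<close>

lemma eval_prod_eq_0_of_degree:
  assumes "\<And>\<alpha>. (\<Sum>i<n. \<alpha> i) < d \<Longrightarrow> \<phi> \<alpha> = 0" and "length hs < d"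
  shows "eval_prod n hs \<phi> = 0"
  using assms
proof (induction hs arbitrary: \<phi> d)
  case Nil
  then show ?case by simp
next
  case (Cons h hs)
  have "apply_form n h \<phi> \<alpha> = 0" if "(\<Sum>i<n. \<alpha> i) < d - 1" for \<alpha>
  proof -
    have "(\<Sum>j<n. (\<alpha>(i := Suc (\<alpha> i))) j) = Suc (\<Sum>j<n. \<alpha> j)" if "i < n" for i
      using that by (simp add: sum.remove[of "{..<n}" i])
    with that show ?thesis
      unfolding apply_form_def by (auto intro!: sum.neutral simp: Cons.prems(1))
  qed
  moreover have "length hs < d - 1" using Cons.prems(2) by simp
  ultimately have "eval_prod n hs (apply_form n h \<phi>) = 0"
    by (rule Cons.IH)
  then show ?case by simp
qed

definition jet :: "nat \<Rightarrow> (nat \<Rightarrow> real) \<Rightarrow> (nat \<Rightarrow> nat) \<Rightarrow> (nat \<Rightarrow> nat) \<Rightarrow> real" where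
  "jet n v s \<alpha> = (\<Prod>i<n. taylor (v i) (s i) (\<alpha> i))"

lemma jet_cong:
  assumes "\<And>i. i < n \<Longrightarrow> v i = v' i" "\<And>i. i < n \<Longrightarrow> s i = s' i"
  shows "jet n v s = jet n v' s'"
  using assms by (auto simp: jet_def fun_eq_iff intro!: prod.cong)

text \<open>Leibniz rule: an affine form has no second derivatives, so only its value at
  \<open>v\<close> and its gradient enter.\<close>

lemma apply_form_jet:
  "apply_form n h (jet n v s) = (\<lambda>\<alpha>. ((\<Sum>i<n. fst h i * v i) - snd h) * jet n v s \<alpha>
     + (\<Sum>i\<in>{i. i < n \<and> s i \<noteq> 0}. fst h i * jet n v (s(i := s i - 1)) \<alpha>))"
proof
  fix \<alpha>
  have step: "jet n v s (\<alpha>(i := Suc (\<alpha> i)))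
      = v i * jet n v s \<alpha> + (if s i = 0 then 0 else jet n v (s(i := s i - 1)) \<alpha>)"
    if i: "i < n" for i
  proof -
    have other: "jet n v s' \<alpha>' = taylor (v i) (s' i) (\<alpha>' i)
        * (\<Prod>j\<in>{..<n} - {i}. taylor (v j) (s' j) (\<alpha>' j))" for s' \<alpha>'
      unfolding jet_def using i by (subst prod.remove[of _ i]) auto
    show ?thesis
      unfolding other by (simp add: taylor_Suc algebra_simps)
  qed
  have "(\<Sum>i<n. fst h i * jet n v s (\<alpha>(i := Suc (\<alpha> i))))
      = (\<Sum>i<n. fst h i * v i) * jet n v s \<alpha>
      + (\<Sum>i<n. if s i \<noteq> 0 then fst h i * jet n v (s(i := s i - 1)) \<alpha> else 0)"
    unfolding sum_distrib_right sum.distrib[symmetric]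
    by (intro sum.cong) (auto simp: step algebra_simps)
  also have "(\<Sum>i<n. if s i \<noteq> 0 then fst h i * jet n v (s(i := s i - 1)) \<alpha> else 0)
      = (\<Sum>i\<in>{i. i < n \<and> s i \<noteq> 0}. fst h i * jet n v (s(i := s i - 1)) \<alpha>)"
    by (subst sum.inter_filter[symmetric]) (auto intro!: sum.cong)
  finally show "apply_form n h (jet n v s) \<alpha> = ((\<Sum>i<n. fst h i * v i) - snd h) * jet n v s \<alpha>
     + (\<Sum>i\<in>{i. i < n \<and> s i \<noteq> 0}. fst h i * jet n v (s(i := s i - 1)) \<alpha>)"
    unfolding apply_form_def by (simp only: left_diff_distrib)
qed

text \<open>A product of r forms through \<open>v\<close> vanishes there to order r. A form through
  \<open>v\<close> kills the first Leibniz term, and the others have total order one less.\<close>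

lemma eval_prod_jet_eq_0:
  assumes "(\<Sum>i<n. s i) < length (filter (\<lambda>h. on_hp n h v) hs)"
  shows "eval_prod n hs (jet n v s) = 0"
  using assms
proof (induction hs arbitrary: s)
  case Nil
  then show ?case by simp
next
  case (Cons h hs)
  have lower: "Suc (\<Sum>j<n. (s(i := s i - 1)) j) = (\<Sum>j<n. s j)" if "i < n" "s i \<noteq> 0" for i
    using that by (simp add: sum.remove[of "{..<n}" i])
  have "eval_prod n hs (jet n v (s(i := s i - 1))) = 0" if i: "i < n" "s i \<noteq> 0" for i
    using lower[OF i] Cons.prems by (intro Cons.IH) (auto split: if_splits)
  moreover have "((\<Sum>i<n. fst h i * v i) - snd h) * eval_prod n hs (jet n v s) = 0"
  proof (cases "on_hp n h v")
    case True
    then show ?thesis by (simp add: on_hp_def)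
  next
    case False
    then show ?thesis using Cons.IH[of s] Cons.prems by simp
  qed
  ultimately show ?case
    by (simp add: apply_form_jet eval_prod_linear)
qed

lemma eval_prod_jet_origin:
  "eval_prod n hs (jet n (\<lambda>_. 0) (\<lambda>_. 0)) = (\<Prod>h\<leftarrow>hs. - snd h)"
proof (induction hs)
  case Nil
  show ?case by (simp add: jet_def taylor_def)
next
  case (Cons h hs)
  have "eval_prod n (h # hs) (jet n (\<lambda>_. 0) (\<lambda>_. 0))
      = eval_prod n hs (\<lambda>\<alpha>. (- snd h) * jet n (\<lambda>_. 0) (\<lambda>_. 0) \<alpha> + (\<Sum>i\<in>({} :: nat set). 0 * 0))"
    by (simp add: apply_form_jet)
  then show ?case
    unfolding eval_prod_linear by (simp add: Cons.IH)
qed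

lemma cov_mset: "cov n (mset hs) x = length (filter (\<lambda>h. on_hp n h x) hs)"
  by (simp add: cov_def flip: mset_filter)

lemma eval_prod_jet_admissible:
  assumes "admissible m n k (mset hs)"
  shows "v \<in> grid m n \<Longrightarrow> v \<noteq> (\<lambda>_. 0) \<Longrightarrow> (\<Sum>i<n. s i) < k \<Longrightarrow> eval_prod n hs (jet n v s) = 0"
    and "eval_prod n hs (jet n (\<lambda>_. 0) (\<lambda>_. 0)) \<noteq> 0"
proof -
  show "eval_prod n hs (jet n v s) = 0"
    if "v \<in> grid m n" "v \<noteq> (\<lambda>_. 0)" "(\<Sum>i<n. s i) < k"
    using assms that eval_prod_jet_eq_0[of s n v hs]
    by (force simp: admissible_def cov_mset)
  show "eval_prod n hs (jet n (\<lambda>_. 0) (\<lambda>_. 0)) \<noteq> 0"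
    using assms by (auto simp: eval_prod_jet_origin admissible_def cov_mset prod_list_zero_iff
        on_hp_def filter_empty_conv)
qed

section \<open>Linear relations between derivatives at the origin\<close>

text \<open>The coefficient of \<open>x\<^sub>0\<^sup>a x\<^sub>1\<^sup>b\<close> in the product of the forms.\<close>

definition origin_jet :: "nat \<Rightarrow> hplane list \<Rightarrow> nat \<Rightarrow> nat \<Rightarrow> real" where
  "origin_jet n hs a b = eval_prod n hs (jet n (\<lambda>_. 0) ((\<lambda>_. 0)(0 := a, 1 := b)))"

text \<open>Away from the origin some coordinates may still sit at node 0, with order up to
  \<open>d i\<close>; \<open>d i < e i\<close> keeps the total order at most \<Sum>(e i - 1) < k
  there. At the origin \<open>d i = 0\<close> leaves only the first two coordinates.\<close>

lemma origin_jet_relation: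
  fixes d e :: "nat \<Rightarrow> nat"
  assumes adm: "admissible m n k (mset hs)"
    and n: "n \<ge> 2"
    and de: "\<And>i. i < n \<Longrightarrow> d i < e i"
    and ek: "(\<Sum>i<n. e i - 1) < k"
    and len: "length hs < (\<Sum>i<n. d i + e i * m)"
    and d2: "\<And>i. i \<ge> 2 \<Longrightarrow> d i = 0"
  shows "(\<Sum>a\<le>d 0. \<Sum>b\<le>d 1.
    hcoeff m (e 0) (d 0 - a) * hcoeff m (e 1) (d 1 - b) * origin_jet n hs a b) = 0"
proof -
  have "\<forall>i. \<exists>\<kappa>. (\<forall>s\<le>d i. \<kappa> (0, s) = hcoeff m (e i) (d i - s)) \<and> (\<forall>j < d i + e i * m.
      (\<Sum>p\<in>nodes m (d i) (e i). \<kappa> p * taylor (real (fst p)) (snd p) j) = 0)"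
    by (intro allI annihilating_functional)
  from choice[OF this] obtain \<kappa> where \<kappa>0: "\<And>i s. s \<le> d i \<Longrightarrow> \<kappa> i (0, s) = hcoeff m (e i) (d i - s)"
    and \<kappa>: "\<And>i j. j < d i + e i * m \<Longrightarrow>
      (\<Sum>p\<in>nodes m (d i) (e i). \<kappa> i p * taylor (real (fst p)) (snd p) j) = 0"
    by blast
  define K where "K = (\<lambda>i. nodes m (d i) (e i))"
  define \<phi> where "\<phi> = (\<lambda>\<alpha>. \<Prod>i<n. \<Sum>p\<in>K i. \<kappa> i p * taylor (real (fst p)) (snd p) (\<alpha> i))"
  define J where "J = (\<lambda>g. jet n (\<lambda>i. real (fst (g i :: nat \<times> nat))) (\<lambda>i. snd (g i)))"
  have finK: "finite (K i)" for i
    by (simp add: K_def nodes_def)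
  \<comment> \<open>Below the total threshold, some exponent is below its own threshold, and that
    factor vanishes.\<close>
  have "\<phi> \<alpha> = 0" if "(\<Sum>i<n. \<alpha> i) < (\<Sum>i<n. d i + e i * m)" for \<alpha>
  proof -
    have "\<not> (\<forall>i\<in>{..<n}. d i + e i * m \<le> \<alpha> i)"
      using that sum_mono[of "{..<n}" "\<lambda>i. d i + e i * m" \<alpha>] by fastforce
    then obtain i where i: "i < n" "\<alpha> i < d i + e i * m"
      by (auto simp: not_le)
    show ?thesis
      unfolding \<phi>_def K_def using i by (intro prod_zero bexI[of _ i] \<kappa>) simp_all
  qed
  then have "eval_prod n hs \<phi> = 0"
    using len by (rule eval_prod_eq_0_of_degree)
  \<comment> \<open>Expanding the product, \<open>g\<close> picks a node and an order in each
    coordinate.\<close>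
  moreover have "\<phi> = (\<lambda>\<alpha>. \<Sum>g\<in>PiE {..<n} K. (\<Prod>i<n. \<kappa> i (g i)) * J g \<alpha>)"
    unfolding \<phi>_def J_def jet_def prod.distrib[symmetric]
    by (rule ext) (simp add: prod_sum_PiE finK)
  ultimately have "(\<Sum>g\<in>PiE {..<n} K. (\<Prod>i<n. \<kappa> i (g i)) * eval_prod n hs (J g)) = 0"
    by (simp add: eval_prod_sum)
  moreover have "(\<Sum>g\<in>PiE {..<n} K. (\<Prod>i<n. \<kappa> i (g i)) * eval_prod n hs (J g))
      = (\<Sum>g\<in>PiE {..<n} (\<lambda>i. {0} \<times> {..d i}). (\<Prod>i<n. \<kappa> i (g i)) * eval_prod n hs (J g))"
  proof (rule sum.mono_neutral_right)
    show "finite (PiE {..<n} K)"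
      by (intro finite_PiE) (auto simp: finK)
    show "PiE {..<n} (\<lambda>i. {0} \<times> {..d i}) \<subseteq> PiE {..<n} K"
      by (intro PiE_mono) (auto simp: K_def nodes_def)
    show "\<forall>g\<in>PiE {..<n} K - PiE {..<n} (\<lambda>i. {0} \<times> {..d i}).
        (\<Prod>i<n. \<kappa> i (g i)) * eval_prod n hs (J g) = 0"
    proof
      fix g assume g: "g \<in> PiE {..<n} K - PiE {..<n} (\<lambda>i. {0} \<times> {..d i})"
      then have gK: "g i \<in> nodes m (d i) (e i)" if "i < n" for i
        using that by (auto simp: K_def)
      obtain i where i: "i < n" "g i \<notin> {0} \<times> {..d i}"
        using g by (auto simp: PiE_iff)
      \<comment> \<open>Extending by 0 beyond \<open>n\<close> is what membership in
        \<open>grid\<close> demands.\<close>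
      define v where "v = (\<lambda>i. if i < n then real (fst (g i)) else 0)"
      have "fst (g i) \<noteq> 0"
        using i(2) gK[OF i(1)] by (cases "g i") (auto simp: nodes_def)
      then have "v i \<noteq> 0" using i(1) by (simp add: v_def)
      then have v0: "v \<noteq> (\<lambda>_. 0)" by auto
      have "fst (g j) \<le> m" if "j < n" for j
        using gK[OF that] by (auto simp: nodes_def)
      then have v: "v \<in> grid m n"
        by (auto simp: grid_def v_def)
      have "snd (g j) \<le> e j - 1" if "j < n" for j
        using gK[OF that] de[OF that] by (auto simp: nodes_def)
      then have "(\<Sum>j<n. snd (g j)) \<le> (\<Sum>j<n. e j - 1)"
        by (intro sum_mono) auto
      then have "eval_prod n hs (jet n v (\<lambda>j. snd (g j))) = 0"
        using eval_prod_jet_admissible(1)[OF adm v v0] ek by simp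
      moreover have "jet n v (\<lambda>j. snd (g j)) = J g"
        unfolding J_def by (rule jet_cong) (auto simp: v_def)
      ultimately show "(\<Prod>i<n. \<kappa> i (g i)) * eval_prod n hs (J g) = 0" by simp
    qed
  qed
  moreover have "(\<Sum>g\<in>PiE {..<n} (\<lambda>i. {0} \<times> {..d i}). (\<Prod>i<n. \<kappa> i (g i)) * eval_prod n hs (J g))
    = (\<Sum>(a, b)\<in>{..d 0} \<times> {..d 1}.
      hcoeff m (e 0) (d 0 - a) * hcoeff m (e 1) (d 1 - b) * origin_jet n hs a b)"
  proof (rule sum.reindex_bij_witness[
        where i = "\<lambda>(a, b). \<lambda>i\<in>{..<n}. (0, ((\<lambda>_. 0)(0 := a, 1 := b)) i)"
          and j = "\<lambda>g. (snd (g 0), snd (g 1))"])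
    fix g :: "nat \<Rightarrow> nat \<times> nat"
    assume g: "g \<in> PiE {..<n} (\<lambda>i. {0} \<times> {..d i})"
    have gi: "fst (g i) = 0" "snd (g i) \<le> d i" if "i < n" for i
      using PiE_mem[OF g, of i] that by auto
    have gd: "g i = (0, ((\<lambda>_. 0)(0 := snd (g 0), 1 := snd (g 1))) i)" if "i < n" for i
      using gi[OF that] d2[of i] by (cases "i = 0"; cases "i = 1") (auto simp: prod_eq_iff)
    show "(\<lambda>(a, b). \<lambda>i\<in>{..<n}. (0, ((\<lambda>_. 0)(0 := a, 1 := b)) i)) (snd (g 0), snd (g 1)) = g"
    proof
      fix i
      show "(\<lambda>(a, b). \<lambda>i\<in>{..<n}. (0, ((\<lambda>_. 0)(0 := a, 1 := b)) i)) (snd (g 0), snd (g 1)) i = g i"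
        by (cases "i < n") (simp_all only: gd[symmetric] prod.case restrict_apply lessThan_iff
            PiE_arb[OF g] if_True if_False simp_thms)
    qed
    show "(snd (g 0), snd (g 1)) \<in> {..d 0} \<times> {..d 1}"
      using gi[of 0] gi[of 1] n by auto
    have "J g = jet n (\<lambda>_. 0) ((\<lambda>_. 0)(0 := snd (g 0), 1 := snd (g 1)))"
      unfolding J_def
    proof (rule jet_cong)
      fix i assume "i < n"
      from gd[OF this] show "snd (g i) = ((\<lambda>_. 0)(0 := snd (g 0), 1 := snd (g 1))) i"
        by (metis snd_conv)
    qed (simp add: gi)
    moreover have "(\<Prod>i<n. \<kappa> i (g i))
        = hcoeff m (e 0) (d 0 - snd (g 0)) * hcoeff m (e 1) (d 1 - snd (g 1))"
    proof -
      have "(\<Prod>i<n. \<kappa> i (g i)) = (\<Prod>i<n. hcoeff m (e i) (d i - snd (g i)))"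
        by (intro prod.cong refl) (metis \<kappa>0 gi lessThan_iff prod.collapse)
      also have "\<dots> = (\<Prod>i\<in>{0, 1}. hcoeff m (e i) (d i - snd (g i)))"
        using n d2 by (intro prod.mono_neutral_right) (auto simp: hcoeff_0)
      finally show ?thesis by simp
    qed
    ultimately show "(case (snd (g 0), snd (g 1)) of (a, b) \<Rightarrow>
        hcoeff m (e 0) (d 0 - a) * hcoeff m (e 1) (d 1 - b) * origin_jet n hs a b)
      = (\<Prod>i<n. \<kappa> i (g i)) * eval_prod n hs (J g)"
      by (simp add: origin_jet_def)
  next
    fix p assume "p \<in> {..d 0} \<times> {..d 1}"
    then show "(\<lambda>(a, b). \<lambda>i\<in>{..<n}. (0, ((\<lambda>_. 0)(0 := a, 1 := b)) i)) p
        \<in> PiE {..<n} (\<lambda>i. {0} \<times> {..d i})"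
      and "(snd ((\<lambda>(a, b). \<lambda>i\<in>{..<n}. (0::nat, ((\<lambda>_. 0)(0 := a, 1 := b)) i)) p 0),
            snd ((\<lambda>(a, b). \<lambda>i\<in>{..<n}. (0::nat, ((\<lambda>_. 0)(0 := a, 1 := b)) i)) p 1)) = p"
      using n by (auto simp: PiE_iff extensional_def)
  qed
  ultimately show ?thesis
    by (simp add: sum.cartesian_product)
qed

text \<open>All further \<open>e i\<close> are 1 and add nothing to \<Sum>(e i - 1), which takes its
  largest allowed value k - 1. For n = 2 there is no coordinate 2, so \<open>e2\<close> must be this
  default.\<close>

lemma origin_jet_relation_three:
  assumes adm: "admissible m n k (mset hs)"
    and n: "n \<ge> 2" "n \<ge> 3 \<or> e2 = 1"
    and e: "e0 + e1 + e2 = k + 2" "d0 < e0" "d1 < e1" "0 < e2"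
    and len: "length hs < d0 + d1 + m * (n + k - 1)"
  shows "(\<Sum>a\<le>d0. \<Sum>b\<le>d1.
    hcoeff m e0 (d0 - a) * hcoeff m e1 (d1 - b) * origin_jet n hs a b) = 0"
proof -
  define d where "d = (\<lambda>_::nat. 0)(0 := d0, 1 := d1)"
  define e where "e = (\<lambda>_::nat. 1)(0 := e0, 1 := e1, 2 := e2)"
  have d_eval: "d 0 = d0" "d 1 = d1" "d (Suc 0) = d1" and d2: "\<And>i. i \<ge> 2 \<Longrightarrow> d i = 0"
    by (auto simp: d_def)
  have e_eval: "e 0 = e0" "e 1 = e1" "e (Suc 0) = e1"
    by (auto simp: e_def)
  have "k \<ge> 1" using e by simp
  have sums: "(\<Sum>i<n. d i) = d0 + d1 \<and> (\<Sum>i<n. e i) = n + k - 1 \<and> (\<Sum>i<n. e i - 1) = k - 1"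
  proof (cases "n \<ge> 3")
    case True
    then obtain l where l: "n = Suc (Suc (Suc l))"
      by (metis Suc_le_D numeral_3_eq_3 Suc_le_mono)
    then show ?thesis
      using e by (auto simp: d_def e_def sum.lessThan_Suc_shift numeral_2_eq_2 simp del: sum.lessThan_Suc)
  next
    case False
    then have "n = 2" "e2 = 1" using n by auto
    then show ?thesis
      using e by (auto simp: d_def e_def numeral_2_eq_2)
  qed
  have "(\<Sum>i<n. d i + e i * m) = d0 + d1 + m * (n + k - 1)"
    using sums by (simp only: sum.distrib sum_distrib_right[symmetric]) simp
  then have "length hs < (\<Sum>i<n. d i + e i * m)" using len by simp
  moreover have "d i < e i" for i
    using e by (auto simp: d_def e_def)
  moreover have "(\<Sum>i<n. e i - 1) < k"
    using sums \<open>k \<ge> 1\<close> by simp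
  ultimately show ?thesis
    using origin_jet_relation[OF adm n(1), of d e] d2 by (simp add: d_eval e_eval)
qed

lemma origin_jet_0: "admissible m n k (mset hs) \<Longrightarrow> origin_jet n hs 0 0 \<noteq> 0"
  using eval_prod_jet_admissible(2)[of m n k hs]
  by (simp add: origin_jet_def fun_upd_idem)

section \<open>Lower bounds for k = 2, 3, 4\<close>

lemma admissible_2_size:
  assumes "admissible m n 2 H" "n \<ge> 2"
  shows "m * n + m \<le> size H"
proof (rule ccontr)
  assume neg: "\<not> ?thesis"
  obtain hs where hs: "H = mset hs" by (metis ex_mset)
  have "length hs < 0 + 0 + m * (n + 2 - 1)"
    using neg hs by simp
  \<comment> \<open>With \<open>d0 = d1 = 0\<close> the relation contains only the value at the
    origin.\<close>
  from origin_jet_relation_three[OF assms(1)[unfolded hs] assms(2) _ _ _ _ _ this, of 1 2 1]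
  show False
    using origin_jet_0[OF assms(1)[unfolded hs]] by (simp add: hcoeff_0)
qed

lemma admissible_3_size:
  assumes "admissible m n 3 H" "n \<ge> 2" "m > 0"
  shows "m * n + (m + 1) * 2 - 1 \<le> size H"
proof (rule ccontr)
  assume neg: "\<not> ?thesis"
  obtain hs where hs: "H = mset hs" by (metis ex_mset)
  note adm = assms(1)[unfolded hs]
  have len: "length hs < 1 + 0 + m * (n + 3 - 1)"
    using neg hs by (simp add: algebra_simps)
  define h where "h = (\<Sum>j=1..m. 1 / real j)"
  have "h > 0" unfolding h_def using \<open>m > 0\<close> by (intro sum_pos) auto
  note rel = origin_jet_relation_three[OF adm assms(2) _ _ _ _ _ len]
  have h1: "hcoeff m e (Suc 0) = real e * h" for e
    using hcoeff_1[of m e] by (simp add: h_def)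
  \<comment> \<open>Taking \<open>e0\<close> to be 3 and then 2 with \<open>d0 = 1\<close> changes
    only the coefficient of the value at the origin, so subtraction removes the derivative.\<close>
  have "3 * h * origin_jet n hs 0 0 + origin_jet n hs 1 0 = 0"
    using rel[of 1 3 1] by (simp add: h1 hcoeff_0)
  moreover have "2 * h * origin_jet n hs 0 0 + origin_jet n hs 1 0 = 0"
    using rel[of 1 2 2] by (simp add: h1 hcoeff_0)
  ultimately have "h * origin_jet n hs 0 0 = 0" by algebra
  then show False
    using origin_jet_0[OF adm] \<open>h > 0\<close> by simp
qed

lemma admissible_4_size:
  assumes "admissible m n 4 H" "n \<ge> 3" "m > 0"
  shows "m * n + (m + 1) * 3 - 1 \<le> size H"
proof (rule ccontr)
  assume neg: "\<not> ?thesis"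
  obtain hs where hs: "H = mset hs" by (metis ex_mset)
  note adm = assms(1)[unfolded hs]
  \<comment> \<open>The excess 2 over m(n + 3) is split into orders (2, 0) and (1, 1).\<close>
  have len2: "length hs < 2 + 0 + m * (n + 4 - 1)" and len1: "length hs < 1 + 1 + m * (n + 4 - 1)"
    using neg hs by (simp_all add: algebra_simps)
  have n: "n \<ge> 2" "n \<ge> 3 \<or> e = 1" for e :: nat
    using assms(2) by auto
  define h where "h = (\<Sum>j=1..m. 1 / real j)"
  define q where "q = (\<Sum>j=1..m. (1 / real j)\<^sup>2)"
  have "h > 0" "q > 0"
    unfolding h_def q_def using \<open>m > 0\<close> by (auto intro!: sum_pos)
  note rel2 = origin_jet_relation_three[OF adm n _ _ _ _ len2]
  note rel1 = origin_jet_relation_three[OF adm n _ _ _ _ len1]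
  have h1: "hcoeff m e (Suc 0) = real e * h" for e
    using hcoeff_1[of m e] by (simp add: h_def)
  have h2: "hcoeff m e 2 = ((real e * h)\<^sup>2 + real e * q) / 2" for e
    using hcoeff_2[of m e] by (simp add: h_def q_def)
  let ?X = "origin_jet n hs"
  \<comment> \<open>The triples \<open>(e0, e1, e2)\<close> are (4, 1, 1) and (3, 2, 1), the latter
    relation doubled, for orders (2, 0); then (2, 3, 1) and (2, 2, 2) for orders (1, 1). The last
    one, with \<open>e2 = 2\<close>, uses \<open>n \<ge> 3\<close>.\<close>
  have "8 * h\<^sup>2 * ?X 0 0 + 2 * q * ?X 0 0 + 4 * h * ?X 1 0 + ?X 2 0 = 0"
    using rel2[of 4 1 1] by (simp add: h1 h2 hcoeff_0 numeral_2_eq_2[symmetric] atMost_nat_numeral field_simps)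
  moreover have "9 * h\<^sup>2 * ?X 0 0 + 3 * q * ?X 0 0 + 6 * h * ?X 1 0 + 2 * ?X 2 0 = 0"
    using rel2[of 3 2 1] by (simp add: h1 h2 hcoeff_0 numeral_2_eq_2[symmetric] atMost_nat_numeral field_simps)
  moreover have "6 * h\<^sup>2 * ?X 0 0 + 2 * h * ?X 0 1 + 3 * h * ?X 1 0 + ?X 1 1 = 0"
    using rel1[of 2 3 1] by (simp add: h1 hcoeff_0 power2_eq_square algebra_simps)
  moreover have "4 * h\<^sup>2 * ?X 0 0 + 2 * h * ?X 0 1 + 2 * h * ?X 1 0 + ?X 1 1 = 0"
    using rel1[of 2 2 2] by (simp add: h1 hcoeff_0 power2_eq_square algebra_simps)
  \<comment> \<open>Twice the first relation, minus the second, minus twice the third, plus twice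
    the fourth.\<close>
  ultimately have "(3 * h\<^sup>2 + q) * ?X 0 0 = 0" by algebra
  moreover have "3 * h\<^sup>2 + q > 0"
    using \<open>q > 0\<close> by (simp add: add_nonneg_pos)
  ultimately show False
    using origin_jet_0[OF adm] by simp
qed

section \<open>The explicit family for the upper bound\<close>

definition coord_planes :: "nat \<Rightarrow> nat \<Rightarrow> hplane multiset" where
  "coord_planes m n = (\<Sum>i<n. \<Sum>j=1..m. {#((\<lambda>l. if l = i then 1 else 0), real j)#})"

definition layer_planes :: "nat \<Rightarrow> nat \<Rightarrow> hplane multiset" where
  "layer_planes m q =
     (\<Sum>w<q. \<Sum>t=1..m. replicate_mset (q - w) ((\<lambda>_. 1), real (w * m + t)))"

lemma size_sum: "size (\<Sum>i\<in>A. F i :: 'a multiset) = (\<Sum>i\<in>A. size (F i))"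
  by (induction A rule: infinite_finite_induct) auto

lemma cov_sum: "cov n (\<Sum>i\<in>A. F i) x = (\<Sum>i\<in>A. cov n (F i) x)"
  by (induction A rule: infinite_finite_induct) (auto simp: cov_def)

lemma cov_replicate_mset: "cov n (replicate_mset c h) x = (if on_hp n h x then c else 0)"
  by (induction c) (auto simp: cov_def)

lemma size_coord_planes: "size (coord_planes m n) = m * n"
  by (simp add: coord_planes_def size_sum)

lemma size_layer_planes: "size (layer_planes m q) = m * (Suc q choose 2)"
proof -
  have "(\<Sum>w<q. q - w) = Suc q choose 2"
  proof (induction q)
    case (Suc q)
    have "(\<Sum>w<Suc q. Suc q - w) = Suc q + (\<Sum>w<q. q - w)"
      by (simp add: sum.lessThan_Suc_shift del: sum.lessThan_Suc)
    then show ?case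
      using Suc by (simp add: numeral_2_eq_2)
  qed simp
  then show ?thesis
    by (simp add: layer_planes_def size_sum sum_distrib_left[symmetric])
qed

lemma cov_coord_planes:
  assumes "x \<in> grid m n"
  shows "cov n (coord_planes m n) x = card {i. i < n \<and> x i \<noteq> 0}"
proof -
  have on: "on_hp n ((\<lambda>l. if l = i then 1 else 0), b) x \<longleftrightarrow> x i = b" if "i < n" for i b
    using that by (simp add: on_hp_def if_distrib[of "\<lambda>c. c * _"] cong: if_cong)
  have "(\<Sum>j=1..m. cov n {#((\<lambda>l. if l = i then 1 else 0), real j)#} x) = (if x i \<noteq> 0 then 1 else 0)"
    if i: "i < n" for i
  proof -
    obtain a where a: "x i = real a" "a \<le> m"
      using assms i by (auto simp: grid_def)
    have "(\<Sum>j=1..m. cov n {#((\<lambda>l. if l = i then 1 else 0), real j)#} x)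
        = (\<Sum>j=1..m. if j = a then 1 else 0)"
      by (intro sum.cong) (auto simp: cov_def on[OF i] a)
    then show ?thesis using a by auto
  qed
  then have "cov n (coord_planes m n) x = (\<Sum>i<n. if x i \<noteq> 0 then 1 else 0)"
    unfolding coord_planes_def cov_sum by (intro sum.cong) auto
  also have "\<dots> = card {i. i < n \<and> x i \<noteq> 0}"
    by (subst sum.inter_filter[symmetric]) auto
  finally show ?thesis .
qed

text \<open>With c nonzero coordinates the coordinate sum is wm + t for some w < c, and that layer
  has \<open>q - w\<close> copies, at least q + 1 - c. For c > q the truncated difference is
  0.\<close>

lemma cov_layer_planes:
  assumes "x \<in> grid m n" "x \<noteq> (\<lambda>_. 0)"
  shows "Suc q - card {i. i < n \<and> x i \<noteq> 0} \<le> cov n (layer_planes m q) x"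
proof -
  define W where "W = {i. i < n \<and> x i \<noteq> 0}"
  have "\<forall>i. \<exists>a. i < n \<longrightarrow> x i = real a \<and> a \<le> m"
    using assms by (auto simp: grid_def)
  then obtain y where y: "\<And>i. i < n \<Longrightarrow> x i = real (y i)" "\<And>i. i < n \<Longrightarrow> y i \<le> m"
    by metis
  define S where "S = (\<Sum>i<n. y i)"
  have xS: "(\<Sum>i<n. x i) = real S"
    unfolding S_def by (simp add: y)
  have "S = (\<Sum>i\<in>W. y i)"
    unfolding S_def by (rule sum.mono_neutral_right) (auto simp: W_def y)
  also have "\<dots> \<le> card W * m"
    using sum_bounded_above[of W y m] y by (auto simp: W_def)
  finally have SW: "S \<le> card W * m" .
  obtain i where "x i \<noteq> 0" using assms(2) by auto
  moreover from this have "i < n"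
    using assms(1) by (auto simp: grid_def simp flip: not_le)
  ultimately have i: "i < n" "y i \<noteq> 0"
    using y by auto
  then have "S > 0"
    unfolding S_def by (meson finite_lessThan lessThan_iff neq0_conv sum_eq_0_iff)
  show ?thesis
  proof (cases "card W \<le> q")
    case False
    then show ?thesis by (simp add: W_def)
  next
    case True
    have "m > 0" using \<open>S > 0\<close> SW by (cases m) auto
    \<comment> \<open>Dividing \<open>S - 1\<close> rather than \<open>S\<close> puts
      \<open>t\<close> in 1, ..., m.\<close>
    define w t where "w = (S - 1) div m" and "t = (S - 1) mod m + 1"
    have St: "S = w * m + t"
      using \<open>S > 0\<close> by (simp add: w_def t_def)
    have t: "t \<in> {1..m}" using \<open>m > 0\<close> by (auto simp: t_def Suc_le_eq)
    have "w < card W"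
      unfolding w_def using SW \<open>S > 0\<close> \<open>m > 0\<close> by (simp add: div_less_iff_less_mult)
    then have w: "w < q" using True by simp
    let ?R = "\<lambda>w t. replicate_mset (q - w) ((\<lambda>_. 1), real (w * m + t)) :: hplane multiset"
    have "q - w = cov n (?R w t) x"
      by (simp add: cov_replicate_mset on_hp_def xS St)
    also have "\<dots> \<le> (\<Sum>t=1..m. cov n (?R w t) x)"
      using t by (intro member_le_sum) auto
    also have "\<dots> \<le> (\<Sum>w<q. \<Sum>t=1..m. cov n (?R w t) x)"
      using w by (intro member_le_sum[where f = "\<lambda>w. \<Sum>t=1..m. cov n (?R w t) x"]) auto
    also have "\<dots> = cov n (layer_planes m q) x"
      by (simp add: layer_planes_def cov_sum)
    finally show ?thesis
      using \<open>w < card W\<close> by (simp add: W_def)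
  qed
qed

lemma admissible_standard:
  assumes "n > 0" "k > 0"
  shows "admissible m n k (coord_planes m n + layer_planes m (k - 1))"
  unfolding admissible_def
proof (intro conjI ballI)
  fix h assume "h \<in># coord_planes m n + layer_planes m (k - 1)"
  then show "is_hyperplane n h"
    using assms by (auto simp: coord_planes_def layer_planes_def set_mset_sum is_hyperplane_def
        split: if_splits)
next
  fix x assume "x \<in> grid m n - {\<lambda>_. 0}"
  then show "k \<le> cov n (coord_planes m n + layer_planes m (k - 1)) x"
    using cov_coord_planes[of x m n] cov_layer_planes[of x m n "k - 1"] assms
    by (auto simp: cov_def)
next
  \<comment> \<open>All right-hand sides \<open>j\<close> and \<open>w * m + t\<close> are
    positive.\<close>
  have "\<not> on_hp n h (\<lambda>_. 0)" if "h \<in># coord_planes m n + layer_planes m (k - 1)" for h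
    using that by (auto simp: coord_planes_def layer_planes_def set_mset_sum on_hp_def
        add_nonneg_eq_0_iff split: if_splits)
  then show "cov n (coord_planes m n + layer_planes m (k - 1)) (\<lambda>_. 0) = 0"
    by (auto simp: cov_def filter_mset_eq_conv)
qed

section \<open>Transfer of the bounds to the minimum\<close>

lemma f_le:
  assumes "n > 0" "k > 0"
  shows "f m n k \<le> m * n + m * (k choose 2)"
  unfolding f_def
  using admissible_standard[OF assms, of m] assms
  by (intro Least_le exI[of _ "coord_planes m n + layer_planes m (k - 1)"])
    (simp add: size_coord_planes size_layer_planes)

text \<open>The explicit family shows that some size occurs, so the \<open>LEAST\<close> is
  attained.\<close>

lemma f_ge:
  assumes "n > 0" "k > 0" and "\<And>H. admissible m n k H \<Longrightarrow> b \<le> size H"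
  shows "b \<le> f m n k"
proof -
  have "\<exists>H. admissible m n k H \<and> size H = f m n k"
    unfolding f_def by (rule LeastI_ex) (use admissible_standard[OF assms(1,2)] in blast)
  then show ?thesis using assms(3) by force
qed

theorem theorem1p4:
  fixes m n :: nat
  assumes "m > 0" and "n > 0"
  shows "(n \<ge> 2 \<longrightarrow> f m n 2 = m * n + m) \<and>
         (\<forall>k\<in>{3, 4}. n \<ge> k - 1 \<longrightarrow>
            m * n + (m + 1) * (k - 1) - 1 \<le> f m n k \<and>
            f m n k \<le> m * n + m * (k choose 2))"
proof (intro conjI impI ballI)
  assume n: "n \<ge> 2"
  show "f m n 2 = m * n + m"
  proof (rule antisym)
    show "f m n 2 \<le> m * n + m"
      using f_le[OF assms(2), of 2 m] by simp
    show "m * n + m \<le> f m n 2"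
      using assms n by (intro f_ge admissible_2_size) auto
  qed
next
  fix k :: nat assume k: "k \<in> {3, 4}" and n: "n \<ge> k - 1"
  show "f m n k \<le> m * n + m * (k choose 2)"
    using k assms by (intro f_le) auto
  consider "k = 3" | "k = 4" using k by auto
  then show "m * n + (m + 1) * (k - 1) - 1 \<le> f m n k"
  proof cases
    case 1
    have "m * n + (m + 1) * 2 - 1 \<le> f m n 3"
      using assms n 1 by (intro f_ge admissible_3_size) auto
    with 1 show ?thesis by simp
  next
    case 2
    have "m * n + (m + 1) * 3 - 1 \<le> f m n 4"
      using assms n 2 by (intro f_ge admissible_4_size) auto
    with 2 show ?thesis by simp
  qed
qed

end
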